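(* For any $r>0$ and $x,h\in H$ with $h\neq\theta$, in each of the following cases the directional derivative $P'_{B_M(r)}(x)(h)$ of the metric projection $P_{B_M(r)}:H\to B_M(r)$ exists and is given as stated. (a) If $x\in B_M^o(r)$, then $$P'_{B_M(r)}(x)(h)=\begin{cases}h,&\text{for }h\in H_M,\\ h_M,&\text{for }h\notin H_M.\end{cases}$$ (b) If $x\in H_M\setminus B_M(r)$, then $$P'_{B_M(r)}(x)(h)=\begin{cases}\dfrac{r}{\|x\|}\left(h-\dfrac{\langle x,h\rangle}{\|x\|^2}x\right),&\text{for }h\in H_M,\\[2mm] \dfrac{r}{\|x\|}\left(h_M-\dfrac{\langle x,h_M\rangle}{\|x\|^2}x\right),&\text{for }h\notin H_M.\end{cases}$$ In particular, $P'_{B_M(r)}(x)(x)=\theta$ for any $x\in H_M\setminus B_M(r)$. (c) If $x\in C_M^o(r)\setminus H_M$, then $P'_{B_M(r)}(x)(h)=h_M$. (d) If $x\in H\setminus(C_M(r)\cup H_M)$, then $$P'_{B_M(r)}(x)(h)=\frac{r}{\|x_M\|}\left(h_M-\frac{\langle x_M,h_M\rangle}{\|x_M\|^2}x_M\right).$$ In particular, $P'_{B_M(r)}(x)(x)=\theta$ for any $x\in H\setminus(C_M(r)\cup H_M)$.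
   Context: $(H,\|\cdot\|)$ is a real Hilbert space with inner product $\langle\cdot,\cdot\rangle$, zero vector $\theta$, and an orthonormal basis $\{e_n\}_{n\in N}$, where $N$ is a set of positive integers with cardinality greater than $1$. $M$ is a nonempty subset of $N$, $H_M$ is the closed subspace of $H$ generated by $\{e_m\}_{m\in M}$, and for $x\in H$, $x_M=\sum_{m\in M}\langle x,e_m\rangle e_m\in H_M$. For $r>0$, $B_M(r)=\{x\in H_M:\|x\|\le r\}$, $B_M^o(r)=\{x\in H_M:\|x\|<r\}$, $C_M(r)=\{x\in H:x_M\in B_M(r)\}$, $C_M^o(r)=\{x\in H:x_M\in B_M^o(r)\}$. For a nonempty closed convex $C\subseteq H$, $P_C:H\to C$ is the metric projection ($P_Cx$ is the unique point of $C$ nearest to $x$), and its directional derivative at $x$ along $v\neq\theta$ is $P_C'(x)(v)=\lim_{t\downarrow0}\frac{P_C(x+tv)-P_C(x)}{t}$ (norm limit), when it exists. *)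

theory Defs
  imports "HOL-Analysis.Analysis"
begin

text \<open>
  A real Hilbert space is a type of sort \<open>{real_inner, complete_space}\<close>.  The family
  \<open>e\<close> is a total function on \<open>nat\<close>; only its values on the index set \<open>N\<close> matter.
\<close>

definition orthonormal_basis :: "nat set \<Rightarrow> (nat \<Rightarrow> 'a::{real_inner,complete_space}) \<Rightarrow> bool" where
  "orthonormal_basis N e \<longleftrightarrow>
     (\<forall>i\<in>N. \<forall>j\<in>N. e i \<bullet> e j = (if i = j then 1 else 0)) \<and> closure (span (e ` N)) = UNIV"

definition gen_subspace :: "(nat \<Rightarrow> 'a::{real_inner,complete_space}) \<Rightarrow> nat set \<Rightarrow> 'a set" where
  "gen_subspace e M = closure (span (e ` M))"

text \<open>
  \<open>M\<close> may be infinite, so the sum is \<open>infsum\<close>, i.e. the norm limit of the net of finite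
  partial sums.
\<close>

definition component :: "(nat \<Rightarrow> 'a::{real_inner,complete_space}) \<Rightarrow> nat set \<Rightarrow> 'a \<Rightarrow> 'a" where
  "component e M x = (\<Sum>\<^sub>\<infinity>m\<in>M. (x \<bullet> e m) *\<^sub>R e m)"

definition closed_ball :: "(nat \<Rightarrow> 'a::{real_inner,complete_space}) \<Rightarrow> nat set \<Rightarrow> real \<Rightarrow> 'a set" where
  "closed_ball e M r = {x \<in> gen_subspace e M. norm x \<le> r}"

definition open_ball :: "(nat \<Rightarrow> 'a::{real_inner,complete_space}) \<Rightarrow> nat set \<Rightarrow> real \<Rightarrow> 'a set" where
  "open_ball e M r = {x \<in> gen_subspace e M. norm x < r}"

definition closed_cylinder :: "(nat \<Rightarrow> 'a::{real_inner,complete_space}) \<Rightarrow> nat set \<Rightarrow> real \<Rightarrow> 'a set" where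
  "closed_cylinder e M r = {x. component e M x \<in> closed_ball e M r}"

definition open_cylinder :: "(nat \<Rightarrow> 'a::{real_inner,complete_space}) \<Rightarrow> nat set \<Rightarrow> real \<Rightarrow> 'a set" where
  "open_cylinder e M r = {x. component e M x \<in> open_ball e M r}"

text \<open>
  The library's \<open>closest_point\<close> requires the sort \<open>heine_borel\<close>, which excludes
  infinite-dimensional spaces.
\<close>

definition metric_projection :: "'a::{real_inner,complete_space} set \<Rightarrow> 'a \<Rightarrow> 'a" where
  "metric_projection C x = (THE y. y \<in> C \<and> (\<forall>z\<in>C. norm (x - y) \<le> norm (x - z)))"

text \<open>
  \<open>has_dir_derivative f x v l\<close> says that the one-sided directional derivative of \<open>f\<close> at
  \<open>x\<close> along \<open>v \<noteq> 0\<close> exists and equals \<open>l\<close>.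
\<close>

definition has_dir_derivative ::
  "('a::{real_inner,complete_space} \<Rightarrow> 'a) \<Rightarrow> 'a \<Rightarrow> 'a \<Rightarrow> 'a \<Rightarrow> bool" where
  "has_dir_derivative f x v l \<longleftrightarrow>
     v \<noteq> 0 \<and> ((\<lambda>t::real. (f (x + t *\<^sub>R v) - f x) /\<^sub>R t) \<longlongrightarrow> l) (at_right 0)"

end

theory Submission
  imports Defs
begin

text \<open>
  The component map \<open>P = component e M\<close> is the orthogonal projection onto \<open>H\<^sub>M\<close>, and for the ball
  \<open>B\<^sub>M(r)\<close> the nearest point to \<open>x\<close> is obtained by first projecting onto \<open>H\<^sub>M\<close> and then pulling
  \<open>P x\<close> radially back into the ball of radius \<open>r\<close>. Since \<open>P\<close> is linear, the directional derivative
  at \<open>x\<close> along \<open>h\<close> is that of the radial retraction at \<open>P x\<close> along \<open>P h\<close>: the retraction is the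
  identity near a point of norm less than \<open>r\<close>, and equals \<open>u \<mapsto> (r / \<parallel>u\<parallel>) u\<close> near a point of norm
  greater than \<open>r\<close>.
\<close>

section \<open>Orthogonal sums and closed spans\<close>

text \<open>By Pythagoras the squared norm of a finite block of the sum is the sum of the squared
  norms over that block, so the Cauchy property passes from the real sums to the partial sums of
  \<open>f\<close>; completeness gives the limit.\<close>

lemma summable_on_orthogonal:
  fixes f :: "'b \<Rightarrow> 'a::{real_inner,complete_space}"
  assumes orth: "pairwise (\<lambda>i j. orthogonal (f i) (f j)) A"
    and sq: "(\<lambda>i. (norm (f i))\<^sup>2) summable_on A"
  shows "f summable_on A"
proof -
  let ?g = "\<lambda>i. (norm (f i))\<^sup>2"
  obtain L where lim: "(sum ?g \<longlongrightarrow> L) (finite_subsets_at_top A)"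
    using sq unfolding has_sum_def summable_on_def by blast
  have "\<exists>P. eventually P (finite_subsets_at_top A) \<and>
          (\<forall>F F'. P F \<and> P F' \<longrightarrow> dist (sum f F) (sum f F') < d)" if d: "d > 0" for d
  proof -
    \<comment> \<open>Two partial sums within \<open>c\<close> of \<open>L\<close> differ by less
      than \<open>2 * c = (d / 2)\<^sup>2\<close>, so the block \<open>F - G\<close> has norm below
      \<open>d / 2\<close>; comparing \<open>F\<close> and \<open>F'\<close> through
      \<open>G\<close> then costs less than \<open>d\<close>.\<close>
    define c where "c = (d / 2)\<^sup>2 / 2"
    have "c > 0" using d by (simp add: c_def)
    then have "\<forall>\<^sub>F F in finite_subsets_at_top A. dist (sum ?g F) L < c"
      using lim tendstoD by blast
    then obtain G where G: "finite G" "G \<subseteq> A"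
      and near': "\<forall>F. finite F \<and> G \<subseteq> F \<and> F \<subseteq> A \<longrightarrow> dist (sum ?g F) L < c"
      unfolding eventually_finite_subsets_at_top by metis
    have near: "dist (sum ?g F) L < c" if "finite F" "G \<subseteq> F" "F \<subseteq> A" for F
      using near' that by simp
    have half: "dist (sum f F) (sum f G) < d / 2" if F: "finite F" "G \<subseteq> F" "F \<subseteq> A" for F
    proof -
      have "(norm (sum f (F - G)))\<^sup>2 = sum ?g (F - G)"
        using F by (intro norm_sum_Pythagorean pairwise_subset[OF orth]) auto
      also have "\<dots> = sum ?g F - sum ?g G"
        using F by (simp add: sum_diff)
      also have "\<dots> < 2 * c"
        using near[OF F] near[OF G(1) order.refl G(2)] unfolding dist_real_def by linarith
      finally have "(norm (sum f (F - G)))\<^sup>2 < (d / 2)\<^sup>2"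
        by (simp add: c_def)
      then have "norm (sum f (F - G)) < d / 2"
        using d power2_less_imp_less by fastforce
      then show ?thesis
        using F by (simp add: sum_diff dist_norm)
    qed
    let ?P = "\<lambda>F. finite F \<and> G \<subseteq> F \<and> F \<subseteq> A"
    have "eventually ?P (finite_subsets_at_top A)"
      using G unfolding eventually_finite_subsets_at_top by blast
    moreover have "dist (sum f F) (sum f F') < d" if "?P F" "?P F'" for F F'
      using half[of F] half[of F'] that by (metis dist_triangle_half_l)
    ultimately show ?thesis
      by (intro exI[of _ ?P] conjI allI impI) auto
  qed
  then have "cauchy_filter (filtermap (sum f) (finite_subsets_at_top A))"
    by (simp add: cauchy_filter_metric_filtermap)
  moreover have "complete (UNIV :: 'a set)"
    by (rule complete_UNIV)
  ultimately obtain l where "filtermap (sum f) (finite_subsets_at_top A) \<le> nhds l"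
    using complete_uniform[where S=UNIV] by force
  then have "(f has_sum l) A"
    by (simp add: has_sum_def filterlim_def)
  then show ?thesis
    using summable_on_def by blast
qed

lemma subspace_closure:
  fixes S :: "'a::real_normed_vector set"
  assumes "subspace S"
  shows "subspace (closure S)"
  unfolding subspace_def
proof (intro conjI ballI allI)
  show "0 \<in> closure S"
    using assms closure_subset subspace_0 by blast
  show "x + y \<in> closure S" if xy: "x \<in> closure S" "y \<in> closure S" for x y
  proof -
    obtain X Y where "\<And>n. X n \<in> S" "X \<longlonglongrightarrow> x" "\<And>n. Y n \<in> S" "Y \<longlonglongrightarrow> y"
      using xy unfolding closure_sequential by auto
    then show ?thesis
      unfolding closure_sequential
      by (intro exI[of _ "\<lambda>n. X n + Y n"]) (auto intro: tendsto_add subspace_add[OF assms])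
  qed
  show "c *\<^sub>R x \<in> closure S" if x: "x \<in> closure S" for c x
  proof -
    obtain X where "\<And>n. X n \<in> S" "X \<longlonglongrightarrow> x"
      using x unfolding closure_sequential by auto
    then show ?thesis
      unfolding closure_sequential
      by (intro exI[of _ "\<lambda>n. c *\<^sub>R X n"]) (auto intro: tendsto_intros subspace_scale[OF assms])
  qed
qed

text \<open>The set \<open>{y. x \<bullet> y = 0}\<close> is a closed subspace, so with
  \<open>S\<close> it contains the closure of the span.\<close>

lemma orthogonal_to_closure_span:
  fixes x :: "'a::real_inner"
  assumes "y \<in> closure (span S)" and "\<And>s. s \<in> S \<Longrightarrow> orthogonal x s"
  shows "orthogonal x y"
proof -
  have "span S \<subseteq> {y. x \<bullet> y = 0}"
    using assms(2) orthogonal_to_span unfolding orthogonal_def by blast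
  moreover have "closed {y. x \<bullet> y = 0}"
    by (rule closed_hyperplane)
  ultimately show ?thesis
    using assms(1) closure_minimal unfolding orthogonal_def by blast
qed

section \<open>Variational criterion for the nearest point\<close>

text \<open>Expanding the square around \<open>y\<close>, the obtuse-angle condition makes the
  squared distance to \<open>z\<close> exceed that to \<open>y\<close> by at least
  \<open>(norm (z - y))\<^sup>2\<close>. This gives both minimality and the uniqueness that
  \<open>THE\<close> requires.\<close>

lemma metric_projection_eqI:
  assumes "y \<in> C" and "\<And>z. z \<in> C \<Longrightarrow> (x - y) \<bullet> (z - y) \<le> 0"
  shows "metric_projection C x = y"
proof -
  have sq: "(norm (x - y))\<^sup>2 + (norm (z - y))\<^sup>2 \<le> (norm (x - z))\<^sup>2" if "z \<in> C" for z
  proof -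
    have "(norm (x - z))\<^sup>2 = (norm (x - y))\<^sup>2 + (norm (z - y))\<^sup>2 - 2 * ((x - y) \<bullet> (z - y))"
      unfolding power2_norm_eq_inner by (simp add: inner_simps inner_commute)
    then show ?thesis
      using assms(2)[OF that] by simp
  qed
  show ?thesis
    unfolding metric_projection_def
  proof (rule the_equality)
    have "norm (x - y) \<le> norm (x - z)" if "z \<in> C" for z
    proof (rule power2_le_imp_le)
      show "(norm (x - y))\<^sup>2 \<le> (norm (x - z))\<^sup>2"
        using sq[OF that] zero_le_power2[of "norm (z - y)"] by linarith
    qed simp
    then show "y \<in> C \<and> (\<forall>z\<in>C. norm (x - y) \<le> norm (x - z))"
      using assms(1) by blast
  next
    fix z assume z: "z \<in> C \<and> (\<forall>w\<in>C. norm (x - z) \<le> norm (x - w))"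
    then have "(norm (x - z))\<^sup>2 \<le> (norm (x - y))\<^sup>2"
      using assms(1) by (simp add: power_mono)
    with sq[of z] z have "(norm (z - y))\<^sup>2 \<le> 0" by linarith
    then show "z = y" by simp
  qed
qed

section \<open>Directional derivatives of the radial retraction\<close>

definition radial_retraction :: "real \<Rightarrow> 'a::real_normed_vector \<Rightarrow> 'a" where
  "radial_retraction r u = (if norm u \<le> r then u else (r / norm u) *\<^sub>R u)"

lemma tendsto_line: "((\<lambda>t. u + t *\<^sub>R k) \<longlongrightarrow> u) (at_right (0::real))"
  for u k :: "'a::real_normed_vector"
  by (rule tendsto_eq_intros refl | simp)+

lemma radial_retraction_dir_derivative_inside:
  assumes "norm u < r"
  shows "((\<lambda>t::real. (radial_retraction r (u + t *\<^sub>R k) - radial_retraction r u) /\<^sub>R t)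
          \<longlongrightarrow> k) (at_right 0)"
proof (rule tendsto_eventually)
  have "\<forall>\<^sub>F t in at_right 0. norm (u + t *\<^sub>R k) < r"
    using order_tendstoD(2)[OF tendsto_norm[OF tendsto_line] assms] .
  moreover have "\<forall>\<^sub>F t in at_right 0. (t::real) > 0"
    by (rule eventually_at_right_less)
  ultimately show "\<forall>\<^sub>F t in at_right 0.
      (radial_retraction r (u + t *\<^sub>R k) - radial_retraction r u) /\<^sub>R t = k"
    by eventually_elim (use assms in \<open>simp add: radial_retraction_def\<close>)
qed

text \<open>For small \<open>t\<close> the retraction is a scalar \<open>?g t\<close> times
  \<open>u + t *\<^sub>R k\<close>. A product rule splits the quotient into the quotient of
  \<open>?g\<close> times \<open>u\<close> plus \<open>?g t\<close> times \<open>k\<close>.\<close>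

lemma radial_retraction_dir_derivative_outside:
  fixes u k :: "'a::real_inner"
  assumes "norm u > r" and "r > 0"
  shows "((\<lambda>t::real. (radial_retraction r (u + t *\<^sub>R k) - radial_retraction r u) /\<^sub>R t)
          \<longlongrightarrow> (r / norm u) *\<^sub>R (k - ((u \<bullet> k) / (norm u)\<^sup>2) *\<^sub>R u)) (at_right 0)"
proof -
  have u: "u \<noteq> 0" using assms by auto
  let ?g = "\<lambda>t::real. r / norm (u + t *\<^sub>R k)"
  \<comment> \<open>The chain rule value of the derivative of \<open>?g\<close> at 0:
    \<open>- r / (norm u)\<^sup>2\<close> times the derivative
    \<open>(u \<bullet> k) / norm u\<close> of the norm along the line.\<close>
  define D where "D = - (r * (u \<bullet> k) / norm u ^ 3)"
  have "((\<lambda>t. norm (u + t *\<^sub>R k)) has_derivative (\<lambda>t. (t *\<^sub>R k) \<bullet> sgn (u + 0 *\<^sub>R k))) (at 0)"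
    using u by (intro has_derivative_compose[where f="\<lambda>t. u + t *\<^sub>R k" and g=norm, OF _ has_derivative_norm])
      (auto intro!: derivative_eq_intros)
  then have "((\<lambda>t. norm (u + t *\<^sub>R k)) has_real_derivative (u \<bullet> k) / norm u) (at 0)"
    by (rule has_derivative_imp_has_field_derivative)
      (simp add: sgn_div_norm inner_commute divide_inverse)
  then have "(?g has_real_derivative D) (at 0)"
    using DERIV_cmult[OF DERIV_inverse_fun, of _ _ 0 UNIV r] u
    by (fastforce simp: D_def divide_inverse power3_eq_cube mult_ac)
  then have "((\<lambda>t. (?g t - ?g 0) / (t - 0)) \<longlongrightarrow> D) (at_right 0)"
    unfolding has_field_derivative_iff by (rule tendsto_mono[rotated]) (simp add: at_le)
  then have D: "((\<lambda>t. (?g t - ?g 0) / t) \<longlongrightarrow> D) (at_right 0)"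
    by simp
  have g: "(?g \<longlongrightarrow> r / norm u) (at_right 0)"
    using u by (intro tendsto_divide tendsto_const tendsto_norm tendsto_line) simp
  have "((\<lambda>t. ((?g t - ?g 0) / t) *\<^sub>R u + ?g t *\<^sub>R k) \<longlongrightarrow> D *\<^sub>R u + (r / norm u) *\<^sub>R k) (at_right 0)"
    by (intro tendsto_intros D g)
  moreover have "D *\<^sub>R u + (r / norm u) *\<^sub>R k
      = (r / norm u) *\<^sub>R (k - ((u \<bullet> k) / (norm u)\<^sup>2) *\<^sub>R u)"
    by (simp add: D_def scaleR_diff_right power2_eq_square power3_eq_cube mult.assoc)
  moreover have "\<forall>\<^sub>F t in at_right 0. ((?g t - ?g 0) / t) *\<^sub>R u + ?g t *\<^sub>R k
      = (radial_retraction r (u + t *\<^sub>R k) - radial_retraction r u) /\<^sub>R t"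
  proof -
    have "\<forall>\<^sub>F t in at_right 0. norm (u + t *\<^sub>R k) > r"
      using order_tendstoD(1)[OF tendsto_norm[OF tendsto_line] assms(1)] .
    moreover have "\<forall>\<^sub>F t in at_right 0. (t::real) > 0"
      by (rule eventually_at_right_less)
    ultimately show ?thesis
    proof eventually_elim
      case (elim t)
      \<comment> \<open>Used with \<open>a = ?g t\<close> and \<open>b = ?g 0\<close>; keeping them
        abstract stops the simplifier from unfolding the norms.\<close>
      have "(a *\<^sub>R (u + t *\<^sub>R k) - b *\<^sub>R u) /\<^sub>R t = ((a - b) / t) *\<^sub>R u + a *\<^sub>R k" for a b
      proof -
        have "a *\<^sub>R (u + t *\<^sub>R k) - b *\<^sub>R u = (a - b) *\<^sub>R u + (a * t) *\<^sub>R k"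
          by (simp add: algebra_simps)
        then have "(a *\<^sub>R (u + t *\<^sub>R k) - b *\<^sub>R u) /\<^sub>R t = ((a - b) *\<^sub>R u + (a * t) *\<^sub>R k) /\<^sub>R t"
          by (rule arg_cong)
        also have "\<dots> = ((a - b) / t) *\<^sub>R u + a *\<^sub>R k"
          using elim by (simp add: scaleR_add_right divide_inverse_commute)
        finally show ?thesis .
      qed
      then show ?case
        using elim assms by (simp add: radial_retraction_def)
    qed
  qed
  ultimately show ?thesis
    using Lim_transform_eventually by force
qed

section \<open>The component map as orthogonal projection\<close>

locale orthonormal_family =
  fixes e :: "nat \<Rightarrow> 'a::{real_inner,complete_space}" and M :: "nat set"
  assumes orthonormal: "i \<in> M \<Longrightarrow> j \<in> M \<Longrightarrow> e i \<bullet> e j = (if i = j then 1 else 0)"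
begin

abbreviation "P \<equiv> component e M"
abbreviation "H \<equiv> gen_subspace e M"

lemma subspace_H: "subspace H"
  unfolding gen_subspace_def by (intro subspace_closure subspace_span)

lemma pairwise_orthogonal: "pairwise (\<lambda>i j. orthogonal ((x \<bullet> e i) *\<^sub>R e i) ((x \<bullet> e j) *\<^sub>R e j)) M"
  by (simp add: pairwise_def orthogonal_def orthonormal)

text \<open>Both \<open>?s \<bullet> ?s\<close> and \<open>x \<bullet> ?s\<close> equal the
  coefficient sum, so the squared norm of the residual \<open>x - ?s\<close> is
  \<open>(norm x)\<^sup>2\<close> minus that sum, and it is nonnegative.\<close>

lemma bessel:
  assumes F: "finite F" "F \<subseteq> M"
  shows "(\<Sum>m\<in>F. (x \<bullet> e m)\<^sup>2) \<le> (norm x)\<^sup>2"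
proof -
  let ?s = "\<Sum>m\<in>F. (x \<bullet> e m) *\<^sub>R e m"
  have "(norm ?s)\<^sup>2 = (\<Sum>m\<in>F. (norm ((x \<bullet> e m) *\<^sub>R e m))\<^sup>2)"
    using F by (intro norm_sum_Pythagorean pairwise_subset[OF pairwise_orthogonal])
  also have "\<dots> = (\<Sum>m\<in>F. (x \<bullet> e m)\<^sup>2)"
    using F by (intro sum.cong) (auto simp: power_mult_distrib power2_norm_eq_inner orthonormal)
  finally have s: "?s \<bullet> ?s = (\<Sum>m\<in>F. (x \<bullet> e m)\<^sup>2)"
    by (simp add: power2_norm_eq_inner)
  have xs: "x \<bullet> ?s = (\<Sum>m\<in>F. (x \<bullet> e m)\<^sup>2)"
    by (simp add: inner_sum_right power2_eq_square)
  have "0 \<le> (x - ?s) \<bullet> (x - ?s)" by simp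
  also have "\<dots> = x \<bullet> x - 2 * (x \<bullet> ?s) + ?s \<bullet> ?s"
    by (simp only: inner_diff_left inner_diff_right inner_commute[of ?s x])
  finally show ?thesis
    using s xs by (simp add: power2_norm_eq_inner)
qed

text \<open>Rules out the default value 0 of \<open>infsum\<close>: Bessel bounds the sums of
  squared coefficients, and summability of orthogonal families lifts this to the vectors.\<close>

lemma has_sum_component: "((\<lambda>m. (x \<bullet> e m) *\<^sub>R e m) has_sum P x) M"
proof -
  have "(\<lambda>m. (x \<bullet> e m)\<^sup>2) summable_on M"
    by (rule nonneg_bdd_above_summable_on) (auto intro!: bdd_aboveI2 bessel)
  moreover have "(x \<bullet> e m)\<^sup>2 = (norm ((x \<bullet> e m) *\<^sub>R e m))\<^sup>2" if "m \<in> M" for m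
    using that by (simp add: power_mult_distrib power2_norm_eq_inner orthonormal)
  ultimately have "(\<lambda>m. (norm ((x \<bullet> e m) *\<^sub>R e m))\<^sup>2) summable_on M"
    using summable_on_cong by force
  then have "(\<lambda>m. (x \<bullet> e m) *\<^sub>R e m) summable_on M"
    by (rule summable_on_orthogonal[OF pairwise_orthogonal])
  then show ?thesis
    unfolding component_def by (rule has_sum_infsum)
qed

lemma component_in: "P x \<in> H"
  unfolding gen_subspace_def
proof (rule Lim_in_closed_set[OF closed_closure _ _ has_sum_component[unfolded has_sum_def]])
  have "sum (\<lambda>m. (x \<bullet> e m) *\<^sub>R e m) F \<in> closure (span (e ` M))" if "F \<subseteq> M" for F
    using that by (intro subsetD[OF closure_subset] span_sum span_scale span_base) auto
  then show "\<forall>\<^sub>F F in finite_subsets_at_top M.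
      sum (\<lambda>m. (x \<bullet> e m) *\<^sub>R e m) F \<in> closure (span (e ` M))"
    by (intro eventually_finite_subsets_at_top_weakI)
qed simp

text \<open>The inner product with \<open>e m\<close> is continuous and linear, so it passes through
  the infinite sum, where orthonormality leaves only the term at \<open>m\<close>.\<close>

lemma inner_component:
  assumes "m \<in> M"
  shows "P x \<bullet> e m = x \<bullet> e m"
proof -
  have "((\<lambda>i. ((x \<bullet> e i) *\<^sub>R e i) \<bullet> e m) has_sum (P x \<bullet> e m)) M"
    using has_sum_bounded_linear[OF bounded_linear_inner_left has_sum_component] .
  moreover have "((\<lambda>i. ((x \<bullet> e i) *\<^sub>R e i) \<bullet> e m) has_sum (x \<bullet> e m)) M"
  proof -
    have "((\<lambda>i. ((x \<bullet> e i) *\<^sub>R e i) \<bullet> e m) has_sum (x \<bullet> e m)) M \<longleftrightarrow>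
        ((\<lambda>i. ((x \<bullet> e i) *\<^sub>R e i) \<bullet> e m) has_sum (x \<bullet> e m)) {m}"
      using assms by (intro has_sum_cong_neutral) (auto simp: orthonormal)
    also have "\<dots>"
      using assms by (intro has_sum_finiteI) (auto simp: orthonormal)
    finally show ?thesis .
  qed
  ultimately show ?thesis
    by (rule has_sum_unique)
qed

text \<open>The residual is orthogonal to every generator by \<open>inner_component\<close>, hence
  to their closed span. Together with \<open>component_in\<close> this identifies \<open>P\<close>
  as the orthogonal projection onto \<open>H\<close>.\<close>

lemma residual_orthogonal:
  assumes "y \<in> H"
  shows "(x - P x) \<bullet> y = 0"
proof -
  have "orthogonal (x - P x) y"
    by (rule orthogonal_to_closure_span[OF assms[unfolded gen_subspace_def]])
      (auto simp: orthogonal_def inner_diff_left inner_component)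
  then show ?thesis by (simp add: orthogonal_def)
qed

text \<open>The residual \<open>x - P x\<close> lies in \<open>H\<close> and is orthogonal to
  \<open>H\<close>, hence to itself.\<close>

lemma component_id:
  assumes "x \<in> H"
  shows "P x = x"
  using residual_orthogonal[of "x - P x" x] subspace_diff[OF subspace_H assms component_in] by simp

lemma component_line: "P (x + t *\<^sub>R h) = P x + t *\<^sub>R P h"
proof -
  have "((\<lambda>m. (x \<bullet> e m) *\<^sub>R e m + t *\<^sub>R ((h \<bullet> e m) *\<^sub>R e m)) has_sum (P x + t *\<^sub>R P h)) M"
    by (intro has_sum_add has_sum_scaleR has_sum_component)
  then have "((\<lambda>m. ((x + t *\<^sub>R h) \<bullet> e m) *\<^sub>R e m) has_sum (P x + t *\<^sub>R P h)) M"
    by (simp add: inner_add_left scaleR_add_left)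
  then show ?thesis
    using has_sum_component has_sum_unique by blast
qed

section \<open>The metric projection onto the ball and its derivatives\<close>

text \<open>The variational criterion is checked. As \<open>z - ?y\<close> lies in \<open>H\<close>,
  the residual drops out and \<open>x\<close> may be replaced by \<open>P x\<close>, which leaves
  the problem for a ball inside \<open>H\<close>.\<close>

lemma metric_projection_closed_ball:
  assumes "r > 0"
  shows "metric_projection (closed_ball e M r) x = radial_retraction r (P x)"
proof (rule metric_projection_eqI)
  let ?y = "radial_retraction r (P x)"
  have yH: "?y \<in> H"
    by (simp add: radial_retraction_def component_in subspace_scale[OF subspace_H])
  have "norm ?y \<le> r"
    using assms by (simp add: radial_retraction_def)
  then show "?y \<in> closed_ball e M r"
    using yH by (simp add: closed_ball_def)
  fix z assume "z \<in> closed_ball e M r"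
  then have z: "z \<in> H" "norm z \<le> r"
    by (auto simp: closed_ball_def)
  have "(x - P x) \<bullet> (z - ?y) = 0"
    by (intro residual_orthogonal subspace_diff[OF subspace_H] z yH)
  then have eq: "(x - ?y) \<bullet> (z - ?y) = (P x - ?y) \<bullet> (z - ?y)"
    by (simp add: inner_diff_left)
  show "(x - ?y) \<bullet> (z - ?y) \<le> 0"
  proof (cases "norm (P x) \<le> r")
    case True
    then show ?thesis
      unfolding eq by (simp add: radial_retraction_def)
  next
    case False
    \<comment> \<open>Here \<open>?y = s *\<^sub>R P x\<close>, so the inner product factors as
      \<open>1 - s \<ge> 0\<close> times \<open>P x \<bullet> z - s * (P x \<bullet> P x)\<close>,
      which Cauchy-Schwarz makes nonpositive.\<close>
    define s where "s = r / norm (P x)"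
    have n: "norm (P x) > 0" "s \<le> 1" "s * norm (P x) = r"
      using False assms by (auto simp: s_def divide_le_eq)
    have "P x \<bullet> z \<le> norm (P x) * norm z"
      by (rule norm_cauchy_schwarz)
    also have "\<dots> \<le> norm (P x) * r"
      using z(2) by (simp add: mult_left_mono)
    also have "\<dots> = s * (P x \<bullet> P x)"
      using n(3) by (simp add: dot_square_norm power2_eq_square flip: mult.assoc)
    finally have "(1 - s) * (P x \<bullet> z - s * (P x \<bullet> P x)) \<le> 0"
      using n(2) by (simp add: mult_nonneg_nonpos)
    moreover have "(P x - s *\<^sub>R P x) \<bullet> (z - s *\<^sub>R P x) = (1 - s) * (P x \<bullet> z - s * (P x \<bullet> P x))"
      by (simp add: inner_diff_left inner_diff_right algebra_simps)
    ultimately show ?thesis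
      unfolding eq using False by (simp add: radial_retraction_def s_def)
  qed
qed

lemma dir_derivative_inside:
  assumes "r > 0" "h \<noteq> 0" "norm (P x) < r"
  shows "has_dir_derivative (metric_projection (closed_ball e M r)) x h (P h)"
  using assms radial_retraction_dir_derivative_inside[of "P x" r "P h"]
  by (simp add: has_dir_derivative_def metric_projection_closed_ball component_line)

lemma dir_derivative_outside:
  assumes "r > 0" "h \<noteq> 0" "norm (P x) > r"
  shows "has_dir_derivative (metric_projection (closed_ball e M r)) x h
    ((r / norm (P x)) *\<^sub>R (P h - ((P x \<bullet> P h) / (norm (P x))\<^sup>2) *\<^sub>R P x))"
  using assms radial_retraction_dir_derivative_outside[of r "P x" "P h"]
  by (simp add: has_dir_derivative_def metric_projection_closed_ball component_line)

text \<open>For \<open>h = x\<close> the coefficient of \<open>P x\<close> in the bracket is 1, so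
  the radial direction is annihilated. The direction is admissible: \<open>P x\<close> is nonzero,
  and \<open>P 0 = 0\<close> then excludes \<open>x = 0\<close>.\<close>

lemma dir_derivative_outside_self:
  assumes "r > 0" "norm (P x) > r"
  shows "has_dir_derivative (metric_projection (closed_ball e M r)) x x 0"
proof -
  have "P 0 = 0"
    by (intro component_id subspace_0 subspace_H)
  then have "x \<noteq> 0" "P x \<noteq> 0"
    using assms by auto
  then show ?thesis
    using dir_derivative_outside[of r x x] assms by (simp add: power2_norm_eq_inner)
qed

end

text \<open>Each claim reduces to comparing \<open>norm (component e M x)\<close> with
  \<open>r\<close>: the open ball and open cylinder give the inside case, the complements of the
  closed ones the outside case. For points or directions in the subspace,
  \<open>component_id\<close> removes the projection.\<close>

theorem theorem6p3:
  fixes N M :: "nat set" and e :: "nat \<Rightarrow> 'a::{real_inner,complete_space}" and r :: real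
  assumes "N \<subseteq> {0<..}" and "infinite N \<or> card N > 1"
    and "orthonormal_basis N e"
    and "M \<subseteq> N" and "M \<noteq> {}"
    and "r > 0"
  shows
    "(\<forall>x h. h \<noteq> 0 \<longrightarrow> x \<in> open_ball e M r \<longrightarrow>
        has_dir_derivative (metric_projection (closed_ball e M r)) x h
          (if h \<in> gen_subspace e M then h else component e M h))
   \<and> (\<forall>x h. h \<noteq> 0 \<longrightarrow> x \<in> gen_subspace e M - closed_ball e M r \<longrightarrow>
        has_dir_derivative (metric_projection (closed_ball e M r)) x h
          (if h \<in> gen_subspace e M
           then (r / norm x) *\<^sub>R (h - ((x \<bullet> h) / (norm x)\<^sup>2) *\<^sub>R x)
           else (r / norm x) *\<^sub>R
             (component e M h - ((x \<bullet> component e M h) / (norm x)\<^sup>2) *\<^sub>R x)))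
   \<and> (\<forall>x. x \<in> gen_subspace e M - closed_ball e M r \<longrightarrow>
        has_dir_derivative (metric_projection (closed_ball e M r)) x x 0)
   \<and> (\<forall>x h. h \<noteq> 0 \<longrightarrow> x \<in> open_cylinder e M r - gen_subspace e M \<longrightarrow>
        has_dir_derivative (metric_projection (closed_ball e M r)) x h (component e M h))
   \<and> (\<forall>x h. h \<noteq> 0 \<longrightarrow> x \<in> UNIV - (closed_cylinder e M r \<union> gen_subspace e M) \<longrightarrow>
        has_dir_derivative (metric_projection (closed_ball e M r)) x h
          ((r / norm (component e M x)) *\<^sub>R
             (component e M h
              - ((component e M x \<bullet> component e M h) / (norm (component e M x))\<^sup>2)
                  *\<^sub>R component e M x)))
   \<and> (\<forall>x. x \<in> UNIV - (closed_cylinder e M r \<union> gen_subspace e M) \<longrightarrow>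
        has_dir_derivative (metric_projection (closed_ball e M r)) x x 0)"
proof -
  interpret orthonormal_family e M
    using assms(3,4) by unfold_locales (metis orthonormal_basis_def subsetD)
  \<comment> \<open>The component always lies in the subspace, so only the norm bound can
    fail.\<close>
  have far: "norm (component e M x) > r" if "x \<notin> closed_cylinder e M r" for x
    using that component_in by (simp add: closed_cylinder_def closed_ball_def)
  have farH: "norm (component e M x) > r" if "x \<in> gen_subspace e M - closed_ball e M r" for x
    using that by (auto simp: closed_ball_def component_id)
  show ?thesis
  proof (intro conjI allI impI)
    fix x h :: 'a assume h: "h \<noteq> 0" and x: "x \<in> open_ball e M r"
    then have "norm (component e M x) < r"
      by (simp add: open_ball_def component_id)
    then show "has_dir_derivative (metric_projection (closed_ball e M r)) x h
        (if h \<in> gen_subspace e M then h else component e M h)"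
      using dir_derivative_inside[OF assms(6) h, of x] component_id[of h] by auto
  next
    fix x h :: 'a assume h: "h \<noteq> 0" and x: "x \<in> gen_subspace e M - closed_ball e M r"
    then show "has_dir_derivative (metric_projection (closed_ball e M r)) x h
        (if h \<in> gen_subspace e M
         then (r / norm x) *\<^sub>R (h - ((x \<bullet> h) / (norm x)\<^sup>2) *\<^sub>R x)
         else (r / norm x) *\<^sub>R
           (component e M h - ((x \<bullet> component e M h) / (norm x)\<^sup>2) *\<^sub>R x))"
      using dir_derivative_outside[OF assms(6) h farH[OF x]] component_id[of x] component_id[of h]
      by auto
  next
    fix x :: 'a assume "x \<in> gen_subspace e M - closed_ball e M r"
    then show "has_dir_derivative (metric_projection (closed_ball e M r)) x x 0"
      by (intro dir_derivative_outside_self assms(6) farH)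
  next
    fix x h :: 'a assume "h \<noteq> 0" "x \<in> open_cylinder e M r - gen_subspace e M"
    then show "has_dir_derivative (metric_projection (closed_ball e M r)) x h (component e M h)"
      by (intro dir_derivative_inside assms(6)) (auto simp: open_cylinder_def open_ball_def)
  next
    fix x h :: 'a assume "h \<noteq> 0" "x \<in> UNIV - (closed_cylinder e M r \<union> gen_subspace e M)"
    then show "has_dir_derivative (metric_projection (closed_ball e M r)) x h
        ((r / norm (component e M x)) *\<^sub>R
           (component e M h
            - ((component e M x \<bullet> component e M h) / (norm (component e M x))\<^sup>2)
                *\<^sub>R component e M x))"
      by (intro dir_derivative_outside assms(6) far) auto
  next
    fix x :: 'a assume "x \<in> UNIV - (closed_cylinder e M r \<union> gen_subspace e M)"
    then show "has_dir_derivative (metric_projection (closed_ball e M r)) x x 0"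
      by (intro dir_derivative_outside_self assms(6) far) auto
  qed
qed

end
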